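(* Let $G$ be a finite simple connected graph that is not a tree. Then $$\operatorname{t}(G)\,\delta'(G)\ \ge\ \operatorname{g}(G)+1 .$$
   Context: For a finite simple graph $G$: $\operatorname{t}(G)$ is the maximum of $|S|$ over vertex sets $S\subseteq V(G)$ such that the induced subgraph $G[S]$ is a tree (connected and acyclic); $\operatorname{g}(G)$ is the girth, i.e. the minimum length of a cycle of $G$; $\delta'(G)$ is the second-smallest degree counted with multiplicity: if the vertex degrees of $G$ are sorted in nondecreasing order $d_1\le d_2\le\cdots\le d_n$ (listed with multiplicity), then $\delta'(G)=d_2$. *)

theory Defs
  imports "Graph_Theory.Graph_Theory" "HOL-Library.Multiset"
begin

text \<open>
  Following the library, a finite simple undirected graph is a finite symmetric digraph without
  loops and parallel arcs (locale \<^locale>\<open>graph\<close>): each undirected edge is a pair of opposite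
  arcs, so the degree of a vertex is its \<^const>\<open>out_degree\<close>. In such a digraph, the closed
  walk a, b, a along a single edge counts as a \<^const>\<open>pre_digraph.cycle\<close>, which makes
  the library notions of forest and tree unsuitable for undirected graphs. The cycles of the
  undirected graph are exactly the library cycles of length at least 3.
\<close>

definition ucycle :: "('a, 'b) pre_digraph \<Rightarrow> 'b awalk \<Rightarrow> bool" where
  "ucycle G p \<longleftrightarrow> pre_digraph.cycle G p \<and> 3 \<le> length p"

definition uacyclic :: "('a, 'b) pre_digraph \<Rightarrow> bool" where
  "uacyclic G \<longleftrightarrow> (\<nexists>p. ucycle G p)"

text \<open>The null graph is not connected in the library, hence is not a tree.\<close>

definition utree :: "('a, 'b) pre_digraph \<Rightarrow> bool" where
  "utree G \<longleftrightarrow> Digraph_Component.connected G \<and> uacyclic G"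

definition max_induced_tree :: "('a, 'b) pre_digraph \<Rightarrow> nat" where
  "max_induced_tree G = Max {card S | S. S \<subseteq> verts G \<and> utree (G \<restriction> S)}"

text \<open>The value is unspecified if there is no cycle.\<close>

definition girth :: "('a, 'b) pre_digraph \<Rightarrow> nat" where
  "girth G = (LEAST n. \<exists>p. ucycle G p \<and> length p = n)"

definition degree_seq :: "('a, 'b) pre_digraph \<Rightarrow> nat list" where
  "degree_seq G = sorted_list_of_multiset (image_mset (out_degree G) (mset_set (verts G)))"

text \<open>Lists are indexed from 0; the value is meaningful for at least two vertices.\<close>

definition second_min_degree :: "('a, 'b) pre_digraph \<Rightarrow> nat" where
  "second_min_degree G = degree_seq G ! 1"

end

theory Submission
  imports Defs
begin

text \<open>
  An inclusion-maximal induced tree T misses some vertex x adjacent to it, and by maximality the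
  connected graph induced by T and x contains a cycle. Hence T has at least g - 1 vertices, which
  suffices if the second smallest degree is at least 2. Otherwise there are two vertices of degree
  1. Starting from a shortest path between them, T can be chosen to contain both; as neither lies
  on a cycle, T has at least (g - 1) + 2 vertices.
\<close>

section \<open>Closed walks and cycles: tails, heads and vertex counts\<close>

lemma (in wf_digraph) cas_tails_heads:
  assumes "cas u p v" "p \<noteq> []"
  shows "map (tail G) p @ [head G (last p)] = tail G (hd p) # map (head G) p"
  using awalk_verts_conv[of u p] awalk_verts_conv'[OF assms(1)] assms(2) by simp

lemma (in wf_digraph) cas_nth_tail:
  assumes "cas u p v" "Suc i < length p"
  shows "tail G (p ! Suc i) = head G (p ! i)"
proof -
  have "p \<noteq> []" using assms(2) by auto
  from arg_cong[OF cas_tails_heads[OF assms(1) this], of "\<lambda>xs. xs ! Suc i"] show ?thesis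
    using assms(2) by (simp add: nth_append)
qed

text \<open>Indexing modulo the length makes the first arc the successor of the last one: both meet
  at \<open>u\<close>. This lets later arguments treat all positions of a cycle alike.\<close>

lemma (in wf_digraph) closed_cas_nth_tail:
  assumes "cas u p u" "i < length p"
  shows "tail G (p ! (Suc i mod length p)) = head G (p ! i)"
proof (cases "Suc i < length p")
  case True
  then show ?thesis using cas_nth_tail[OF assms(1)] by simp
next
  case False
  then have i: "Suc i = length p" using assms(2) by simp
  then have ne: "p \<noteq> []" by auto
  have "tail G (hd p) = u" using assms(1) ne by (simp add: cas_simp)
  moreover have "head G (last p) = u"
    using assms(1) ne by (induction p arbitrary: u rule: rev_induct) auto
  moreover have "last p = p ! i" using i ne by (simp add: last_conv_nth flip: i)
  ultimately show ?thesis using i ne by (simp add: hd_conv_nth)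
qed

text \<open>The tails followed by the start vertex form the same list as the start vertex followed
  by the heads. Cancelling that vertex from the multisets leaves the claim.\<close>

lemma (in wf_digraph) cycle_tails_eq_heads:
  assumes "cycle p"
  shows "tail G ` set p = head G ` set p"
proof -
  from assms obtain u where u: "awalk u p u" and ne: "p \<noteq> []"
    unfolding cycle_def by blast
  from u have cas: "cas u p u" by (auto simp: awalk_def)
  note cas_tails_heads[OF cas ne]
  moreover have "head G (last p) = tail G (hd p)"
    using closed_cas_nth_tail[OF cas, of "length p - 1"] ne
    by (simp add: last_conv_nth hd_conv_nth)
  ultimately have "mset (map (tail G) p @ [tail G (hd p)]) = mset (tail G (hd p) # map (head G) p)"
    by metis
  then have "mset (map (tail G) p) = mset (map (head G) p)" by simp
  then show ?thesis by (metis image_set mset_eq_setD)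
qed

text \<open>The distinctness built into \<open>cycle\<close> concerns the vertex list without its
  first entry, that is, the heads; the previous lemma transfers the count to the tails.\<close>

lemma (in wf_digraph) card_cycle_verts:
  assumes "cycle p"
  shows "card (tail G ` set p) = length p"
proof -
  from assms obtain u where u: "awalk u p u" "distinct (tl (awalk_verts u p))" "p \<noteq> []"
    unfolding cycle_def by blast
  from u have "distinct (map (head G) p)"
    using awalk_verts_conv'[of u p u] by (auto simp: awalk_def)
  then show ?thesis
    unfolding cycle_tails_eq_heads[OF assms] by (metis distinct_card length_map list.set_map)
qed

text \<open>The successor and the predecessor of \<open>v\<close> on the cycle are two different
  neighbours. Used mainly in contraposition: a vertex of degree at most 1 lies on no cycle.\<close>

lemma (in graph) out_degree_cycle_ge_2:
  assumes "ucycle G p" "v \<in> tail G ` set p"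
  shows "2 \<le> out_degree G v"
proof -
  from assms(1) have cyc: "cycle p" and len: "3 \<le> length p" by (auto simp: ucycle_def)
  from cyc obtain u where u: "awalk u p u" "distinct (tl (awalk_verts u p))"
    unfolding cycle_def by blast
  have arcs: "set p \<subseteq> arcs G" and cas: "cas u p u" using u(1) by (auto simp: awalk_def)
  have dist: "distinct (map (head G) p)"
    using u(2) awalk_verts_conv'[OF cas] len by (cases p) auto
  let ?n = "length p"
  from assms(2) obtain k where k: "k < ?n" "tail G (p ! k) = v"
    by (auto simp: in_set_conv_nth)
  \<comment> \<open>Cyclically, \<open>i\<close> is two places before \<open>k\<close>, written
    without truncated subtraction. Arc \<open>j\<close> enters \<open>v\<close>, so
    \<open>head G (p ! i)\<close> is the predecessor of \<open>v\<close>.\<close>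
  define i where "i = (k + (?n - 2)) mod ?n"
  define j where "j = Suc i mod ?n"
  have n0: "0 < ?n" using len by linarith
  have ij: "i < ?n" "j < ?n" using n0 by (simp_all add: i_def j_def)
  have "Suc j mod ?n = (k + (?n - 2) + 2) mod ?n"
    by (simp add: i_def j_def mod_simps)
  also have "k + (?n - 2) + 2 = k + ?n" using len by simp
  also have "\<dots> mod ?n = k" using k by simp
  finally have kj: "Suc j mod ?n = k" .
  \<comment> \<open>Length at least 3 matters here: on a closed walk of length 2 the indices
    \<open>i\<close> and \<open>k\<close> would coincide.\<close>
  have "i = (if k < 2 then k + (?n - 2) else k - 2)"
  proof (cases "k < 2")
    case False
    then have "k + (?n - 2) = (k - 2) + ?n" using len by simp
    then have "i = ((k - 2) + ?n) mod ?n" by (simp only: i_def)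
    moreover have "k - 2 < ?n" using k by simp
    ultimately show ?thesis using False by (simp only: mod_add_self2 mod_less if_False)
  qed (use len in \<open>simp add: i_def\<close>)
  then have ik: "i \<noteq> k" using len by (simp split: if_splits)
  have "tail G (p ! j) = head G (p ! i)"
    using closed_cas_nth_tail[OF cas ij(1)] by (simp add: j_def)
  moreover have "head G (p ! j) = v"
    using closed_cas_nth_tail[OF cas ij(2)] kj k by simp
  moreover have "p ! j \<in> arcs G" using arcs ij by (meson nth_mem subsetD)
  ultimately obtain e where e: "e \<in> arcs G" "tail G e = v" "head G e = head G (p ! i)"
    using sym_arcs unfolding symmetric_conv by metis
  have "head G (p ! i) \<noteq> head G (p ! k)"
    using dist ik ij k by (metis distinct_conv_nth length_map nth_map)
  then have "e \<noteq> p ! k" using e by auto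
  moreover have "{e, p ! k} \<subseteq> out_arcs G v"
    using e k arcs by auto
  ultimately show ?thesis
    unfolding out_degree_def
    using card_mono[OF finite_out_arcs, of "{e, p ! k}" v] card_2_iff[of "{e, p ! k}"] by metis
qed

section \<open>Induced subgraphs and their growth by one vertex\<close>

lemma (in graph) graph_induce:
  assumes "S \<subseteq> verts G"
  shows "graph (G \<restriction> S)"
proof -
  have "induced_subgraph (G \<restriction> S) G" using assms by (rule induced_induce)
  then show ?thesis
    using digraphI_induced induced_graph_imp_symmetric[OF sym_arcs] digraph.graphI by blast
qed

text \<open>Constraining the tails is enough, because the heads of a cycle form the same
  set.\<close>

lemma (in wf_digraph) ucycle_induce_iff:
  "ucycle (G \<restriction> S) p \<longleftrightarrow> ucycle G p \<and> tail G ` set p \<subseteq> S"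
proof -
  interpret S: wf_digraph "G \<restriction> S" by (rule wellformed_induce_subgraph)
  have cas: "S.cas = cas" by (rule compatible_cas) (rule compatible_induce_subgraph)
  show ?thesis
  proof
    assume S: "ucycle (G \<restriction> S) p"
    then obtain u where "S.awalk u p u" "distinct (tl (S.awalk_verts u p))" "p \<noteq> []" "3 \<le> length p"
      unfolding ucycle_def S.cycle_def by blast
    then show "ucycle G p \<and> tail G ` set p \<subseteq> S"
      by (cases p) (auto simp: ucycle_def cycle_def awalk_verts_induce awalk_def S.awalk_def cas
          intro!: exI[of _ u])
  next
    assume G: "ucycle G p \<and> tail G ` set p \<subseteq> S"
    then obtain u where u: "awalk u p u" "distinct (tl (awalk_verts u p))" "p \<noteq> []" "3 \<le> length p"
      unfolding ucycle_def cycle_def by blast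
    have "head G ` set p \<subseteq> S"
      using G cycle_tails_eq_heads by (auto simp: ucycle_def)
    then show "ucycle (G \<restriction> S) p"
      using u G by (cases p) (auto simp: ucycle_def S.cycle_def awalk_verts_induce awalk_def S.awalk_def cas
          intro!: exI[of _ u])
  qed
qed

lemma (in graph) connected_iff_reachable:
  "connected G \<longleftrightarrow> verts G \<noteq> {} \<and> (\<forall>u\<in>verts G. \<forall>v\<in>verts G. u \<rightarrow>\<^sup>* v)"
  using reachable_mk_symmetric_eq[OF sym_arcs]
  by (simp add: connected_def strongly_connected_def)

lemma (in graph) connected_induce_insert:
  assumes "S \<subseteq> verts G" "connected (G \<restriction> S)" "v \<in> S" "v \<rightarrow> w"
  shows "connected (G \<restriction> insert w S)"
proof -
  interpret S: graph "G \<restriction> S" using assms(1) by (rule graph_induce)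
  have "insert w S \<subseteq> verts G" using assms adj_in_verts by blast
  then interpret I: graph "G \<restriction> insert w S" by (rule graph_induce)
  have "v \<rightarrow>\<^bsub>G \<restriction> insert w S\<^esub> w" using assms(3,4) by (auto simp: arcs_ends_conv)
  then have "w \<rightarrow>\<^sup>*\<^bsub>G \<restriction> insert w S\<^esub> v" using I.symmetric_reachable' by blast
  moreover have "u \<rightarrow>\<^sup>*\<^bsub>G \<restriction> insert w S\<^esub> v" if "u \<in> S" for u
    using that assms S.connected_iff_reachable reachable_induce_ss[of S u v "insert w S"] by auto
  ultimately have "u \<rightarrow>\<^sup>*\<^bsub>G \<restriction> insert w S\<^esub> v" if "u \<in> insert w S" for u
    using that by blast
  then show ?thesis
    unfolding I.connected_iff_reachable using I.symmetric_reachable' I.reachable_trans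
    by (metis induce_subgraph_verts insert_not_empty)
qed

text \<open>The new vertex \<open>w\<close> is a leaf, so no cycle passes through it; a cycle of the
  larger graph would therefore already lie in \<open>S\<close>.\<close>

lemma (in graph) utree_induce_insert:
  assumes "S \<subseteq> verts G" "utree (G \<restriction> S)" "v \<in> S" "v \<rightarrow> w" "w \<notin> S"
    and unique: "\<And>y. y \<in> S \<Longrightarrow> w \<rightarrow> y \<Longrightarrow> y = v"
  shows "utree (G \<restriction> insert w S)"
proof -
  have sub: "insert w S \<subseteq> verts G" using assms adj_in_verts by blast
  then interpret I: graph "G \<restriction> insert w S" by (rule graph_induce)
  have "e = f" if "e \<in> out_arcs (G \<restriction> insert w S) w" "f \<in> out_arcs (G \<restriction> insert w S) w" for e f
  proof -
    have "head G a = v" if "a \<in> out_arcs (G \<restriction> insert w S) w" for a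
      using that unique[of "head G a"] no_loops[of a] in_arcs_imp_in_arcs_ends[of a] by auto
    then show ?thesis using that no_multi_arcs[of e f] by (auto simp: arc_to_ends_def)
  qed
  then have deg: "out_degree (G \<restriction> insert w S) w \<le> 1"
    unfolding out_degree_def by (metis One_nat_def card_le_Suc0_iff_eq I.finite_out_arcs)
  have "\<not> ucycle (G \<restriction> insert w S) p" for p
  proof
    assume p: "ucycle (G \<restriction> insert w S) p"
    then have "w \<notin> tail G ` set p" using I.out_degree_cycle_ge_2[OF p, of w] deg by auto
    then have "ucycle (G \<restriction> S) p" using p by (auto simp: ucycle_induce_iff)
    then show False using assms(2) by (auto simp: utree_def uacyclic_def)
  qed
  then show ?thesis
    using connected_induce_insert[OF assms(1) _ assms(3,4)] assms(2)
    by (auto simp: utree_def uacyclic_def)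
qed

lemma (in graph) utree_induce_singleton:
  assumes "u \<in> verts G"
  shows "utree (G \<restriction> {u})"
proof -
  interpret S: graph "G \<restriction> {u}" using assms by (intro graph_induce) simp
  have "\<not> ucycle (G \<restriction> {u}) p" for p
  proof
    assume p: "ucycle (G \<restriction> {u}) p"
    then have "p \<noteq> []" by (auto simp: ucycle_def)
    then have "hd p \<in> arcs (G \<restriction> {u})" using p
      by (cases p) (auto simp: ucycle_def S.cycle_def S.awalk_def)
    then show False using S.no_loops[of "hd p"] by auto
  qed
  then show ?thesis by (auto simp: utree_def uacyclic_def S.connected_iff_reachable)
qed

text \<open>A shortest walk induces a path. The last conjunct strengthens the induction: all
  vertices of \<open>S\<close> except the endpoint are closer to \<open>u\<close> than
  \<open>n\<close>, which forbids shortcuts to the next vertex.\<close>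

lemma (in graph) shortest_walk_utree:
  assumes "u \<in> verts G"
  shows "(u, v) \<in> arcs_ends G ^^ n \<Longrightarrow> (\<And>m. m < n \<Longrightarrow> (u, v) \<notin> arcs_ends G ^^ m) \<Longrightarrow>
    \<exists>S\<subseteq>verts G. u \<in> S \<and> v \<in> S \<and> utree (G \<restriction> S) \<and>
      (\<forall>w\<in>S - {v}. \<exists>m<n. (u, w) \<in> arcs_ends G ^^ m)"
proof (induction n arbitrary: v)
  case 0
  then show ?case using assms utree_induce_singleton by (intro exI[of _ "{u}"]) auto
next
  case (Suc n w)
  from Suc.prems(1) obtain v where v: "(u, v) \<in> arcs_ends G ^^ n" "v \<rightarrow> w" by auto
  \<comment> \<open>A shorter walk to \<open>v\<close> would extend to a shorter walk to
    \<open>w\<close>.\<close>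
  have "(u, v) \<notin> arcs_ends G ^^ m" if "m < n" for m
    using that v(2) Suc.prems(2) Suc_mono relpow_Suc_I by metis
  from Suc.IH[OF v(1) this] obtain S where S: "S \<subseteq> verts G" "u \<in> S" "v \<in> S" "utree (G \<restriction> S)"
    and near: "\<forall>y\<in>S - {v}. \<exists>m<n. (u, y) \<in> arcs_ends G ^^ m" by blast
  have near': "\<exists>m<Suc n. (u, y) \<in> arcs_ends G ^^ m" if "y \<in> S" for y
    using that near v(1) by (metis DiffI less_Suc_eq singletonD)
  then have w: "w \<notin> S" using Suc.prems(2) by blast
  \<comment> \<open>Another neighbour \<open>y\<close> in \<open>S\<close> would be reached in fewer
    than \<open>n\<close> steps, hence \<open>w\<close> in fewer than \<open>Suc n\<close>.\<close>
  have "y = v" if "y \<in> S" "w \<rightarrow> y" for y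
  proof (rule ccontr)
    assume "y \<noteq> v"
    with \<open>y \<in> S\<close> have "y \<in> S - {v}" by simp
    then obtain m where m: "m < n" "(u, y) \<in> arcs_ends G ^^ m" using bspec[OF near] by metis
    have "y \<rightarrow> w" using that(2) by (rule graph_symmetric)
    with m(2) have "(u, w) \<in> arcs_ends G ^^ Suc m" by (rule relpow_Suc_I)
    then show False using Suc.prems(2) m(1) Suc_mono by metis
  qed
  then have "utree (G \<restriction> insert w S)" using S v(2) w by (intro utree_induce_insert)
  moreover have "insert w S \<subseteq> verts G" using S v adj_in_verts by blast
  ultimately show ?case using S near' by (intro exI[of _ "insert w S"]) auto
qed

lemma (in graph) utree_containing_two:
  assumes "connected G" "u \<in> verts G" "v \<in> verts G"
  obtains S where "S \<subseteq> verts G" "u \<in> S" "v \<in> S" "utree (G \<restriction> S)"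
proof -
  have "u \<rightarrow>\<^sup>* v" using assms connected_iff_reachable by blast
  then have "(u, v) \<in> (arcs_ends G)\<^sup>*" by (rule reachable_rtranclI)
  then obtain k where "(u, v) \<in> arcs_ends G ^^ k" using rtrancl_imp_relpow by blast
  then obtain n where "(u, v) \<in> arcs_ends G ^^ n" "\<And>m. m < n \<Longrightarrow> (u, v) \<notin> arcs_ends G ^^ m"
    using exists_least_iff[of "\<lambda>n. (u, v) \<in> arcs_ends G ^^ n"] by blast
  then show thesis using shortest_walk_utree[OF assms(2)] that by blast
qed

section \<open>Maximal induced trees against the girth\<close>

lemma (in graph) card_le_max_induced_tree:
  assumes "S \<subseteq> verts G" "utree (G \<restriction> S)"
  shows "card S \<le> max_induced_tree G"
proof -
  have "finite {card S | S. S \<subseteq> verts G \<and> utree (G \<restriction> S)}"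
    by (rule finite_subset[of _ "card ` Pow (verts G)"]) auto
  then show ?thesis unfolding max_induced_tree_def using assms by (intro Max_ge) auto
qed

lemma (in graph) adj_leaving_set:
  assumes "connected G" "S \<subseteq> verts G" "S \<noteq> {}" "S \<noteq> verts G"
  obtains v w where "v \<in> S" "w \<notin> S" "v \<rightarrow> w"
proof -
  obtain a b where ab: "a \<in> S" "b \<in> verts G" "b \<notin> S" using assms by blast
  have "a \<rightarrow>\<^sup>* b" using assms(1,2) ab connected_iff_reachable by blast
  \<comment> \<open>The implication serves as invariant along the walk from \<open>a\<close>: once
    outside \<open>S\<close>, the walk has crossed its boundary.\<close>
  then have "b \<notin> S \<longrightarrow> (\<exists>v\<in>S. \<exists>w. w \<notin> S \<and> v \<rightarrow> w)"
    by (induction rule: reachable_induct) (use ab in auto)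
  then show thesis using ab that by blast
qed

lemma (in graph) maximal_induced_tree_cycle:
  assumes "connected G" "\<not> utree G" "S \<subseteq> verts G" "utree (G \<restriction> S)"
  obtains T x p where "S \<subseteq> T" "T \<subseteq> verts G" "utree (G \<restriction> T)" "ucycle G p"
    "tail G ` set p \<subseteq> insert x T"
proof -
  let ?P = "\<lambda>T. S \<subseteq> T \<and> T \<subseteq> verts G \<and> utree (G \<restriction> T)"
  have "finite {T. ?P T}" by (rule finite_subset[of _ "Pow (verts G)"]) auto
  then obtain T where T: "?P T" and max: "\<And>T'. ?P T' \<Longrightarrow> T \<subseteq> T' \<Longrightarrow> T = T'"
    using finite_has_maximal2[of "{T. ?P T}" S] assms(3,4) by auto
  have "T \<noteq> verts G"
    using T assms(2) induce_eq_iff_induced[OF induced_subgraph_refl] by auto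
  moreover have "T \<noteq> {}" using T by (auto simp: utree_def connected_conv)
  ultimately obtain v x where vx: "v \<in> T" "x \<notin> T" "v \<rightarrow> x"
    using adj_leaving_set assms(1) T by metis
  have "connected (G \<restriction> insert x T)"
    using connected_induce_insert T vx by (auto simp: utree_def)
  \<comment> \<open>Maximality of \<open>T\<close> excludes a larger tree; since connectedness
    survives, acyclicity must fail.\<close>
  moreover have "\<not> utree (G \<restriction> insert x T)"
    using max[of "insert x T"] T vx adj_in_verts by blast
  ultimately obtain p where "ucycle (G \<restriction> insert x T) p" by (auto simp: utree_def uacyclic_def)
  then show thesis using T that by (auto simp: ucycle_induce_iff)
qed

lemma girth_le_length: "ucycle G p \<Longrightarrow> girth G \<le> length p"
  unfolding girth_def by (rule Least_le) blast

lemma girth_ge_3: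
  assumes "ucycle G p"
  shows "3 \<le> girth G"
proof -
  have "\<exists>q. ucycle G q \<and> length q = girth G"
    unfolding girth_def by (rule LeastI_ex) (use assms in blast)
  then show ?thesis by (auto simp: ucycle_def)
qed

text \<open>The set \<open>L\<close> of low-degree vertices is disjoint from the cycle, and both fit
  into \<open>T\<close> plus one vertex. It is applied with two leaves and with the empty
  set.\<close>

lemma (in graph) girth_le_max_induced_tree:
  assumes "connected G" "\<not> utree G" "S \<subseteq> verts G" "utree (G \<restriction> S)"
    "\<And>v. v \<in> L \<Longrightarrow> v \<in> S \<and> out_degree G v \<le> 1"
  shows "girth G + card L \<le> max_induced_tree G + 1"
proof -
  obtain T x p where T: "S \<subseteq> T" "T \<subseteq> verts G" "utree (G \<restriction> T)" "ucycle G p"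
    "tail G ` set p \<subseteq> insert x T"
    using maximal_induced_tree_cycle[OF assms(1-4)] .
  have fin: "finite T" using T(2) finite_verts by (rule finite_subset)
  have L: "L \<subseteq> T" using assms(5) T(1) by blast
  have "tail G ` set p \<inter> L = {}"
    using out_degree_cycle_ge_2[OF T(4)] assms(5) by fastforce
  then have "length p + card L = card (tail G ` set p \<union> L)"
    using card_cycle_verts T(4) L fin finite_subset
    by (subst card_Un_disjoint) (auto simp: ucycle_def)
  also have "\<dots> \<le> card (insert x T)" using T(5) L fin by (intro card_mono) auto
  also have "\<dots> \<le> card T + 1" using fin by (simp add: card_insert_if)
  also have "\<dots> \<le> max_induced_tree G + 1" using card_le_max_induced_tree T by simp
  finally show ?thesis using girth_le_length[OF T(4)] by linarith
qed

section \<open>From the degree sequence to vertices of small degree\<close>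

lemma (in graph) out_degree_pos:
  assumes "connected G" "v \<in> verts G" "verts G \<noteq> {v}"
  shows "0 < out_degree G v"
proof -
  obtain w where "v \<rightarrow> w" using adj_leaving_set[of "{v}"] assms by auto
  then obtain e where "e \<in> out_arcs G v" by auto
  then show ?thesis unfolding out_degree_def using finite_out_arcs card_gt_0_iff by blast
qed

lemma sorted_nth_1_le_imp_size_filter:
  fixes M :: "'a::linorder multiset"
  assumes "2 \<le> size M" "sorted_list_of_multiset M ! 1 \<le> k"
  shows "2 \<le> size {#x \<in># M. x \<le> k#}"
proof -
  define xs where "xs = sorted_list_of_multiset M"
  have M: "M = mset xs" by (simp add: xs_def)
  have "sorted xs" by (simp add: xs_def)
  obtain a b ys where xs: "xs = a # b # ys"
    using assms(1) unfolding M by (cases xs rule: remdups_adj.cases) auto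
  then have "a \<le> k" "b \<le> k" using assms(2) \<open>sorted xs\<close> by (auto simp: xs_def[symmetric])
  then show ?thesis by (simp add: M xs)
qed

text \<open>The degree sequence has one entry per vertex, so two small entries come from two
  distinct vertices, even when the degrees agree.\<close>

lemma (in fin_digraph) second_min_degree_cases:
  assumes "2 \<le> card (verts G)" "second_min_degree G \<le> k"
  obtains u v where "u \<in> verts G" "v \<in> verts G" "u \<noteq> v" "out_degree G u \<le> k" "out_degree G v \<le> k"
proof -
  have "2 \<le> size {#d \<in># image_mset (out_degree G) (mset_set (verts G)). d \<le> k#}"
    using assms by (intro sorted_nth_1_le_imp_size_filter)
      (auto simp: second_min_degree_def degree_seq_def)
  also have "\<dots> = card {v \<in> verts G. out_degree G v \<le> k}"
    by (simp add: filter_mset_image_mset)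
  finally obtain B where "B \<subseteq> {v \<in> verts G. out_degree G v \<le> k}" "card B = 2"
    by (meson obtain_subset_with_card_n)
  then show thesis using that by (auto simp: card_2_iff)
qed

theorem theorem4p1:
  fixes G :: "('a, 'b) pre_digraph"
  assumes "graph G"
    and "Digraph_Component.connected G"
    and "\<not> utree G"
  shows "max_induced_tree G * second_min_degree G \<ge> girth G + 1"
proof -
  interpret graph G by fact
  from assms(2,3) obtain p where p: "ucycle G p" by (auto simp: utree_def uacyclic_def)
  have "card (tail G ` set p) \<le> card (verts G)"
    using p by (intro card_mono) (auto simp: ucycle_def cycle_def awalk_def)
  \<comment> \<open>In particular, index 1 of the degree sequence is in range.\<close>
  then have n: "3 \<le> card (verts G)" using p card_cycle_verts by (auto simp: ucycle_def)
  have g: "3 \<le> girth G" using p by (rule girth_ge_3)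
  show ?thesis
  proof (cases "second_min_degree G \<le> 1")
    case True
    then obtain u v where uv: "u \<in> verts G" "v \<in> verts G" "u \<noteq> v"
      "out_degree G u \<le> 1" "out_degree G v \<le> 1"
      using second_min_degree_cases[of 1] n by auto
    obtain S where "S \<subseteq> verts G" "u \<in> S" "v \<in> S" "utree (G \<restriction> S)"
      using utree_containing_two assms(2) uv by metis
    then have "girth G + card {u, v} \<le> max_induced_tree G + 1"
      using assms(2,3) uv by (intro girth_le_max_induced_tree) auto
    \<comment> \<open>A connected graph on at least three vertices has no isolated vertex, so the
      second smallest degree is exactly 1 in this case.\<close>
    moreover have "second_min_degree G \<noteq> 0"
    proof
      assume "second_min_degree G = 0"
      then obtain w where "w \<in> verts G" "out_degree G w = 0"
        using second_min_degree_cases[of 0] n by auto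
      moreover have "verts G \<noteq> {w}" using n by auto
      ultimately show False using out_degree_pos[of w] assms(2) by simp
    qed
    ultimately show ?thesis using uv(3) True by (simp add: le_Suc_eq) linarith
  next
    case False
    obtain u where "u \<in> verts G" using n by fastforce
    then have "girth G + card ({} :: 'a set) \<le> max_induced_tree G + 1"
      using assms(2,3) utree_induce_singleton
      by (intro girth_le_max_induced_tree[where S = "{u}"]) simp_all
    \<comment> \<open>Twice \<open>girth G - 1\<close> is at least \<open>girth G + 1\<close>
      precisely because the girth is at least 3.\<close>
    then have "girth G + 1 \<le> max_induced_tree G * 2" using g by simp
    also have "\<dots> \<le> max_induced_tree G * second_min_degree G" using False by simp
    finally show ?thesis .
  qed
qed

end
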